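(* A zero-dimensional Hausdorff space $X$ is a $P$-space if and only if each (proper) ideal in $C_c(X)$ is closed in the $m_c$-topology on $C_c(X)$.
   Context: A space is zero-dimensional if its clopen sets form a base for its topology. A (Tychonoff) space is a $P$-space if every $G_\delta$-set in it is open. $C_c(X)$ is the ring of real-valued continuous functions on $X$ with countable range. The $m_c$-topology on $C_c(X)$ is the topology with open base consisting of all sets $M(g,u)=\{f\in C_c(X): |f(x)-g(x)|<u(x)\text{ for each }x\in X\}$, where $g\in C_c(X)$ and $u$ is a positive unit of $C_c(X)$ (a unit with $u(x)>0$ for all $x$). *)

theory Defs
  imports "HOL-Analysis.Analysis" "HOL-Algebra.Ideal"
begin

definition zero_dimensional_space :: "'a topology \<Rightarrow> bool" where
  "zero_dimensional_space X \<longleftrightarrow>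
     openin X = arbitrary union_of (\<lambda>C. openin X C \<and> closedin X C)"

definition Tychonoff_space :: "'a topology \<Rightarrow> bool" where
  "Tychonoff_space X \<longleftrightarrow> completely_regular_space X \<and> Hausdorff_space X"

definition P_space :: "'a topology \<Rightarrow> bool" where
  "P_space X \<longleftrightarrow> Tychonoff_space X \<and> (\<forall>S. gdelta_in X S \<longrightarrow> openin X S)"

text \<open>Functions on the space are represented by their extensional versions, so that two
  elements of the ring agree on \<^term>\<open>topspace X\<close> iff they are equal. All ring
  operations are pointwise.\<close>

definition Cc :: "'a topology \<Rightarrow> ('a \<Rightarrow> real) ring" where
  "Cc X =
    \<lparr>carrier = {f \<in> extensional (topspace X).
                  continuous_map X euclideanreal f \<and> countable (f ` topspace X)},
     mult = (\<lambda>f g. \<lambda>x\<in>topspace X. f x * g x),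
     one = (\<lambda>x\<in>topspace X. 1),
     zero = (\<lambda>x\<in>topspace X. 0),
     add = (\<lambda>f g. \<lambda>x\<in>topspace X. f x + g x)\<rparr>"

definition positive_unit :: "'a topology \<Rightarrow> ('a \<Rightarrow> real) \<Rightarrow> bool" where
  "positive_unit X u \<longleftrightarrow> u \<in> Units (Cc X) \<and> (\<forall>x\<in>topspace X. 0 < u x)"

definition mc_ball :: "'a topology \<Rightarrow> ('a \<Rightarrow> real) \<Rightarrow> ('a \<Rightarrow> real) \<Rightarrow> ('a \<Rightarrow> real) set" where
  "mc_ball X g u = {f \<in> carrier (Cc X). \<forall>x\<in>topspace X. \<bar>f x - g x\<bar> < u x}"

text \<open>That the sets below do form a base is proved as \<open>openin_mc_topology\<close>.\<close>

definition mc_topology :: "'a topology \<Rightarrow> ('a \<Rightarrow> real) topology" where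
  "mc_topology X = topology (arbitrary union_of
     (\<lambda>M. \<exists>g u. g \<in> carrier (Cc X) \<and> positive_unit X u \<and> M = mc_ball X g u))"

lemma Cc_simps:
  "f \<in> carrier (Cc X) \<longleftrightarrow> f \<in> extensional (topspace X) \<and>
     continuous_map X euclideanreal f \<and> countable (f ` topspace X)"
  "f \<otimes>\<^bsub>Cc X\<^esub> g = (\<lambda>x\<in>topspace X. f x * g x)"
  "f \<oplus>\<^bsub>Cc X\<^esub> g = (\<lambda>x\<in>topspace X. f x + g x)"
  "\<one>\<^bsub>Cc X\<^esub> = (\<lambda>x\<in>topspace X. 1)"
  "\<zero>\<^bsub>Cc X\<^esub> = (\<lambda>x\<in>topspace X. 0)"
  by (auto simp: Cc_def)

lemma restrict_in_Cc:
  assumes "continuous_map X euclideanreal f" "countable (f ` topspace X)"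
  shows "restrict f (topspace X) \<in> carrier (Cc X)"
proof -
  have "continuous_map X euclideanreal (restrict f (topspace X))"
    using assms(1) by (rule continuous_map_eq) simp
  then show ?thesis
    using assms(2) by (simp add: Cc_simps)
qed

lemma countable_image2:
  assumes "countable (f ` S)" "countable (g ` S)"
  shows "countable ((\<lambda>x. F (f x) (g x)) ` S)"
proof (rule countable_subset)
  show "(\<lambda>x. F (f x) (g x)) ` S \<subseteq> (\<lambda>(a, b). F a b) ` (f ` S \<times> g ` S)"
    by auto
qed (use assms in auto)

lemma cring_Cc: "cring (Cc X)"
proof (rule cringI)
  show "abelian_group (Cc X)"
  proof (rule abelian_groupI)
    fix f assume f: "f \<in> carrier (Cc X)"
    have "countable ((\<lambda>x. - f x) ` topspace X)"
      using f countable_image2[of f "topspace X" f "\<lambda>a b. - a"] by (simp add: Cc_simps)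
    then have "restrict (\<lambda>x. - f x) (topspace X) \<in> carrier (Cc X)"
      using f by (intro restrict_in_Cc continuous_map_minus) (auto simp: Cc_simps)
    then show "\<exists>g\<in>carrier (Cc X). g \<oplus>\<^bsub>Cc X\<^esub> f = \<zero>\<^bsub>Cc X\<^esub>"
      by (rule rev_bexI) (simp add: Cc_simps(2-) cong: restrict_cong)
  next
    fix f g assume "f \<in> carrier (Cc X)" "g \<in> carrier (Cc X)"
    then show "f \<oplus>\<^bsub>Cc X\<^esub> g \<in> carrier (Cc X)"
      unfolding Cc_simps(3)
      by (intro restrict_in_Cc continuous_map_add countable_image2[where F = "(+)"]) (auto simp: Cc_simps)
  next
    show "\<zero>\<^bsub>Cc X\<^esub> \<in> carrier (Cc X)"
      unfolding Cc_simps(5) by (rule restrict_in_Cc) (simp_all add: image_constant_conv)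
  next
    fix f assume "f \<in> carrier (Cc X)"
    then show "\<zero>\<^bsub>Cc X\<^esub> \<oplus>\<^bsub>Cc X\<^esub> f = f"
      by (simp add: Cc_simps extensional_restrict cong: restrict_cong)
  qed (simp_all add: Cc_simps(2-) ac_simps cong: restrict_cong)
  show "comm_monoid (Cc X)"
  proof (rule comm_monoidI)
    fix f g assume "f \<in> carrier (Cc X)" "g \<in> carrier (Cc X)"
    then show "f \<otimes>\<^bsub>Cc X\<^esub> g \<in> carrier (Cc X)"
      unfolding Cc_simps(2)
      by (intro restrict_in_Cc continuous_map_real_mult countable_image2[where F = "(*)"]) (auto simp: Cc_simps)
  next
    show "\<one>\<^bsub>Cc X\<^esub> \<in> carrier (Cc X)"
      unfolding Cc_simps(4) by (rule restrict_in_Cc) (simp_all add: image_constant_conv)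
  next
    fix f assume "f \<in> carrier (Cc X)"
    then show "\<one>\<^bsub>Cc X\<^esub> \<otimes>\<^bsub>Cc X\<^esub> f = f"
      by (simp add: Cc_simps extensional_restrict cong: restrict_cong)
  qed (simp_all add: Cc_simps(2-) ac_simps cong: restrict_cong)
qed (simp add: Cc_simps(2-) distrib_right cong: restrict_cong)

lemma positive_unit_iff:
  "positive_unit X u \<longleftrightarrow> u \<in> carrier (Cc X) \<and> (\<forall>x\<in>topspace X. 0 < u x)"
proof (safe)
  assume u: "u \<in> carrier (Cc X)" and pos: "\<forall>x\<in>topspace X. 0 < u x"
  define v where "v = restrict (\<lambda>x. inverse (u x)) (topspace X)"
  have "countable ((\<lambda>x. inverse (u x)) ` topspace X)"
    using u countable_image2[of u "topspace X" u "\<lambda>a b. inverse a"] by (simp add: Cc_simps)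
  moreover have nz: "u x \<noteq> 0" if "x \<in> topspace X" for x
    using pos that by force
  then have "continuous_map X euclideanreal (\<lambda>x. inverse (u x))"
    using u by (intro continuous_map_real_inverse) (simp_all add: Cc_simps(1))
  ultimately have v: "v \<in> carrier (Cc X)"
    unfolding v_def by (rule restrict_in_Cc[rotated])
  have "v \<otimes>\<^bsub>Cc X\<^esub> u = \<one>\<^bsub>Cc X\<^esub>" "u \<otimes>\<^bsub>Cc X\<^esub> v = \<one>\<^bsub>Cc X\<^esub>"
    using nz by (simp_all add: Cc_simps(2-) v_def cong: restrict_cong)
  then show "positive_unit X u"
    using u v pos by (auto simp: positive_unit_def Units_def)
qed (auto simp: positive_unit_def Units_def)

lemma openin_mc_topology:
  "openin (mc_topology X) = arbitrary union_of
     (\<lambda>M. \<exists>g u. g \<in> carrier (Cc X) \<and> positive_unit X u \<and> M = mc_ball X g u)"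
  (is "_ = arbitrary union_of ?P")
proof -
  have sub: "\<exists>M. ?P M \<and> f \<in> M \<and> M \<subseteq> mc_ball X g u \<inter> mc_ball X h v"
    if g: "g \<in> carrier (Cc X)" and h: "h \<in> carrier (Cc X)"
      and u: "positive_unit X u" and v: "positive_unit X v"
      and f: "f \<in> mc_ball X g u \<inter> mc_ball X h v" for f g h u v
  proof -
    have fC: "f \<in> carrier (Cc X)" and uC: "u \<in> carrier (Cc X)" and vC: "v \<in> carrier (Cc X)"
      using f u v by (auto simp: mc_ball_def positive_unit_iff)
    define w where
      "w = restrict (\<lambda>x. min (u x - \<bar>f x - g x\<bar>) (v x - \<bar>f x - h x\<bar>)) (topspace X)"
    have "w \<in> carrier (Cc X)"
      unfolding w_def
    proof (rule restrict_in_Cc)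
      show "continuous_map X euclideanreal (\<lambda>x. min (u x - \<bar>f x - g x\<bar>) (v x - \<bar>f x - h x\<bar>))"
        using fC g h uC vC
        by (intro continuous_map_real_min continuous_map_diff continuous_map_real_abs)
          (auto simp: Cc_simps)
      show "countable ((\<lambda>x. min (u x - \<bar>f x - g x\<bar>) (v x - \<bar>f x - h x\<bar>)) ` topspace X)"
        using fC g h uC vC unfolding Cc_simps
        by (intro countable_image2[where F = min]
            countable_image2[where F = "\<lambda>a b. a - \<bar>b\<bar>"] countable_image2[where F = "(-)"]) auto
    qed
    moreover have "\<forall>x\<in>topspace X. 0 < w x"
      using f by (auto simp: w_def mc_ball_def)
    ultimately have w: "positive_unit X w"
      by (simp add: positive_unit_iff)
    have 1: "f \<in> mc_ball X f w"
      using w fC by (auto simp: mc_ball_def positive_unit_def)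
    have 2: "mc_ball X f w \<subseteq> mc_ball X g u \<inter> mc_ball X h v"
      unfolding mc_ball_def w_def by fastforce
    show ?thesis
      using fC w 1 2 by blast
  qed
  have "istopology (arbitrary union_of ?P)"
    unfolding istopology_base_eq
  proof (intro allI impI)
    fix S T assume "?P S \<and> ?P T"
    then obtain g u h v where gh: "g \<in> carrier (Cc X)" "h \<in> carrier (Cc X)"
        "positive_unit X u" "positive_unit X v"
      and ST: "S = mc_ball X g u" "T = mc_ball X h v"
      by (elim conjE exE) simp
    have "\<exists>M. ?P M \<and> f \<in> M \<and> M \<subseteq> S \<inter> T" if "f \<in> S \<inter> T" for f
      using sub[OF gh] that unfolding ST .
    then have "\<exists>\<U> \<subseteq> Collect ?P. \<Union>\<U> = S \<inter> T"
      by (intro exI[of _ "{M. ?P M \<and> M \<subseteq> S \<inter> T}"]) blast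
    then show "(arbitrary union_of ?P) (S \<inter> T)"
      by (simp add: union_of_def arbitrary_def)
  qed
  then show ?thesis
    by (simp add: mc_topology_def)
qed

lemma topspace_mc_topology: "topspace (mc_topology X) = carrier (Cc X)"
proof
  show "topspace (mc_topology X) \<subseteq> carrier (Cc X)"
    using openin_topspace[of "mc_topology X"]
    unfolding openin_mc_topology union_of_def arbitrary_def by (auto simp: mc_ball_def)
  show "carrier (Cc X) \<subseteq> topspace (mc_topology X)"
  proof
    fix f assume f: "f \<in> carrier (Cc X)"
    have u: "positive_unit X (\<one>\<^bsub>Cc X\<^esub>)"
      using cring.cring_simprules(6)[OF cring_Cc]
      by (simp add: positive_unit_iff) (simp add: Cc_simps(4))
    have "openin (mc_topology X) (mc_ball X f (\<one>\<^bsub>Cc X\<^esub>))"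
      unfolding openin_mc_topology using f u by (intro arbitrary_union_of_inc) blast
    moreover have "f \<in> mc_ball X f (\<one>\<^bsub>Cc X\<^esub>)"
      using f by (simp add: mc_ball_def Cc_simps(4))
    ultimately show "f \<in> topspace (mc_topology X)"
      using openin_subset by blast
  qed
qed

end

theory Submission
  imports Defs
begin

text \<open>In a P-space the zero set of a continuous \<open>f\<close> is clopen, so there is a positive unit \<open>u\<close>
  equal to \<open>\<bar>f\<bar> / 2\<close> off the zero set. Any \<open>g\<close> with \<open>\<bar>g - f\<bar> < u\<close> vanishes nowhere off the
  zero set, hence divides \<open>f\<close>; so an ideal that comes that close to \<open>f\<close> contains \<open>f\<close>.
  Conversely, the functions vanishing near \<open>x\<close> form an ideal that is dense in the functions
  vanishing at \<open>x\<close>. If it is closed, every zero set of \<open>C\<^sub>c(X)\<close> containing \<open>x\<close> is a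
  neighbourhood of \<open>x\<close>, and zero-dimensionality puts such a zero set inside any given
  \<open>G\<^sub>\<delta>\<close>-set around \<open>x\<close>.\<close>

section \<open>Clopen sets and functions pasted along them\<close>

lemma zero_dimensional_space_clopen_base:
  assumes "zero_dimensional_space X" "openin X U" "x \<in> U"
  obtains C where "openin X C" "closedin X C" "x \<in> C" "C \<subseteq> U"
proof -
  have "(arbitrary union_of (\<lambda>C. openin X C \<and> closedin X C)) U"
    using assms by (simp add: zero_dimensional_space_def)
  then show thesis
    using \<open>x \<in> U\<close> that by (auto simp: union_of_def arbitrary_def)
qed

lemma continuous_map_clopen_cases:
  assumes C: "openin X C" "closedin X C"
    and f: "continuous_map X Y f" and g: "continuous_map X Y g"
  shows "continuous_map X Y (\<lambda>x. if x \<in> C then f x else g x)"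
  unfolding continuous_map_def
proof (intro conjI allI impI)
  show "(\<lambda>x. if x \<in> C then f x else g x) \<in> topspace X \<rightarrow> topspace Y"
    using f g by (auto simp: continuous_map_def)
next
  fix U assume U: "openin Y U"
  have "{x \<in> topspace X. (if x \<in> C then f x else g x) \<in> U} =
      C \<inter> {x \<in> topspace X. f x \<in> U} \<union> (topspace X - C) \<inter> {x \<in> topspace X. g x \<in> U}"
    by auto
  moreover have "openin X (topspace X - C)"
    using C by auto
  ultimately show "openin X {x \<in> topspace X. (if x \<in> C then f x else g x) \<in> U}"
    using C(1) f g U by (simp add: openin_Int openin_Un continuous_map_def)
qed

text \<open>The indicator of the complement of a clopen neighbourhood is a separating function. This
  supplies the Tychonoff condition inside \<open>P_space\<close> for the converse direction.\<close>

lemma zero_dimensional_imp_completely_regular_space: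
  assumes "zero_dimensional_space X"
  shows "completely_regular_space X"
  unfolding completely_regular_space_alt'
proof (intro allI impI)
  fix S x assume "openin X S" "x \<in> S"
  then obtain C where C: "openin X C" "closedin X C" "x \<in> C" "C \<subseteq> S"
    using assms zero_dimensional_space_clopen_base by metis
  have "continuous_map X euclideanreal (\<lambda>y. if y \<in> C then 0 else 1)"
    using C by (intro continuous_map_clopen_cases) auto
  then show "\<exists>f. continuous_map X euclideanreal f \<and> f x = 0 \<and> f ` (topspace X - S) \<subseteq> {1}"
    using C by (intro exI[of _ "\<lambda>y. if y \<in> C then 0 else 1"]) auto
qed

text \<open>The new range lies in the union of two countable ranges. Both directions of the theorem
  alter a function on a clopen set in this way.\<close>

lemma Cc_clopen_cases:
  assumes "openin X C" "closedin X C" "f \<in> carrier (Cc X)" "g \<in> carrier (Cc X)"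
  shows "(\<lambda>x\<in>topspace X. if x \<in> C then f x else g x) \<in> carrier (Cc X)"
proof (rule restrict_in_Cc)
  show "continuous_map X euclideanreal (\<lambda>x. if x \<in> C then f x else g x)"
    using assms by (intro continuous_map_clopen_cases) (auto simp: Cc_simps)
  have "(\<lambda>x. if x \<in> C then f x else g x) ` topspace X \<subseteq> f ` topspace X \<union> g ` topspace X"
    by auto
  then show "countable ((\<lambda>x. if x \<in> C then f x else g x) ` topspace X)"
    using assms by (auto simp: Cc_simps intro: countable_subset)
qed

lemma const_in_Cc: "(\<lambda>x\<in>topspace X. c) \<in> carrier (Cc X)"
  by (rule restrict_in_Cc) (simp_all add: image_constant_conv)

lemma Cc_divide:
  assumes "f \<in> carrier (Cc X)" "g \<in> carrier (Cc X)" "\<And>x. x \<in> topspace X \<Longrightarrow> g x \<noteq> 0"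
  shows "(\<lambda>x\<in>topspace X. f x / g x) \<in> carrier (Cc X)"
  using assms
  by (intro restrict_in_Cc continuous_map_real_divide countable_image2[where F = "(/)"])
    (auto simp: Cc_simps)

section \<open>Zero sets of continuous functions\<close>

lemma openin_abs_less:
  assumes "continuous_map X euclideanreal f" "continuous_map X euclideanreal g"
  shows "openin X {x \<in> topspace X. \<bar>f x\<bar> < g x}"
proof -
  have "continuous_map X euclideanreal (\<lambda>x. g x - \<bar>f x\<bar>)"
    using assms by (intro continuous_intros)
  then have "openin X {x \<in> topspace X. g x - \<bar>f x\<bar> \<in> {0<..}}"
    by (rule openin_continuous_map_preimage) auto
  then show ?thesis
    by simp
qed

lemma gdelta_in_zero_set:
  assumes "continuous_map X euclideanreal f"
  shows "gdelta_in X {x \<in> topspace X. f x = 0}"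
  unfolding gdelta_in_descending
proof (intro exI conjI allI)
  let ?U = "\<lambda>n. {x \<in> topspace X. \<bar>f x\<bar> < inverse (real (Suc n))}"
  show "openin X (?U n)" for n
    using assms by (intro openin_abs_less) auto
  show "?U (Suc n) \<subseteq> ?U n" for n
  proof -
    have "inverse (real (Suc (Suc n))) \<le> inverse (real (Suc n))"
      by (intro le_imp_inverse_le) auto
    then show ?thesis
      by (auto intro: less_le_trans)
  qed
  have "f x = 0" if "\<forall>n. \<bar>f x\<bar> < inverse (real (Suc n))" for x
  proof (rule ccontr)
    assume "f x \<noteq> 0"
    then obtain n where "inverse (real (Suc n)) < \<bar>f x\<bar>"
      using reals_Archimedean[of "\<bar>f x\<bar>"] by auto
    with that show False
      by (meson less_asym)
  qed
  then show "\<Inter> (range ?U) = {x \<in> topspace X. f x = 0}"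
    by auto
qed

text \<open>Closedness is mere continuity; openness is the P-space property applied to a zero set as
  a G-delta set. Here the forward direction uses \<open>P_space\<close>.\<close>

lemma P_space_clopen_zero_set:
  assumes "P_space X" "continuous_map X euclideanreal f"
  shows "openin X {x \<in> topspace X. f x = 0}" "closedin X {x \<in> topspace X. f x = 0}"
proof -
  show "openin X {x \<in> topspace X. f x = 0}"
    using assms gdelta_in_zero_set by (auto simp: P_space_def)
  have "closedin X {x \<in> topspace X. f x \<in> {0}}"
    using assms(2) by (rule closedin_continuous_map_preimage) auto
  then show "closedin X {x \<in> topspace X. f x = 0}"
    by simp
qed

section \<open>Basic neighbourhoods, and ideals over a P-space\<close>

lemma openin_mc_ball:
  "g \<in> carrier (Cc X) \<Longrightarrow> positive_unit X u \<Longrightarrow> openin (mc_topology X) (mc_ball X g u)"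
  unfolding openin_mc_topology by (intro arbitrary_union_of_inc) blast

lemma openin_mc_topology_mc_ball:
  assumes "openin (mc_topology X) V" "f \<in> V"
  obtains g u where "g \<in> carrier (Cc X)" "positive_unit X u" "f \<in> mc_ball X g u"
    "mc_ball X g u \<subseteq> V"
proof -
  obtain \<U> where \<U>: "\<U> \<subseteq> {M. \<exists>g u. g \<in> carrier (Cc X) \<and> positive_unit X u \<and> M = mc_ball X g u}"
      and V: "\<Union>\<U> = V"
    using assms(1) unfolding openin_mc_topology union_of_def arbitrary_def by auto
  from V assms(2) obtain M where "M \<in> \<U>" "f \<in> M"
    by auto
  then show thesis
    using \<U> V that by blast
qed

lemma P_space_imp_closedin_ideal:
  assumes P: "P_space X" and I: "ideal I (Cc X)"
  shows "closedin (mc_topology X) I"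
proof -
  have sub: "I \<subseteq> carrier (Cc X)"
    using I by (simp add: additive_subgroup.a_subset ideal.axioms(1))
  have ball: "\<exists>U. openin (mc_topology X) U \<and> f \<in> U \<and> U \<subseteq> carrier (Cc X) - I"
    if f: "f \<in> carrier (Cc X) - I" for f
  proof -
    define Z where "Z = {x \<in> topspace X. f x = 0}"
    have Z: "openin X Z" "closedin X Z"
      using P_space_clopen_zero_set[OF P] f by (auto simp: Z_def Cc_simps)
    \<comment> \<open>The 1 is an arbitrary positive filler: \<open>|f| / 2\<close> vanishes on
      \<open>Z\<close>, where a unit may not. The inner restrictions match the form of
      \<open>Cc_clopen_cases\<close>.\<close>
    define u where "u = (\<lambda>x\<in>topspace X. if x \<in> Z then (\<lambda>x\<in>topspace X. 1) x
        else (\<lambda>x\<in>topspace X. \<bar>f x\<bar> / 2) x)"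
    have "(\<lambda>x\<in>topspace X. \<bar>f x\<bar> / 2) \<in> carrier (Cc X)"
      using f by (intro restrict_in_Cc continuous_intros countable_image2[where F = "\<lambda>a b. \<bar>a\<bar> / 2"])
        (auto simp: Cc_simps)
    then have "u \<in> carrier (Cc X)"
      unfolding u_def by (intro Cc_clopen_cases Z const_in_Cc)
    then have u: "positive_unit X u"
      by (simp add: positive_unit_iff u_def Z_def)
    have "f \<in> I" if g: "g \<in> I" "g \<in> mc_ball X f u" for g
    proof -
      \<comment> \<open>\<open>g\<close> may vanish on \<open>Z\<close>, so it is replaced by 1
        there before dividing. Off \<open>Z\<close> the product of \<open>g\<close> and
        \<open>h\<close> is \<open>g * (f / g) = f\<close>; on \<open>Z\<close> it is 0 because
        \<open>h\<close> inherits the zeros of \<open>f\<close>.\<close>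
      define k where "k = (\<lambda>x\<in>topspace X. if x \<in> Z then (\<lambda>x\<in>topspace X. 1) x else g x)"
      define h where "h = (\<lambda>x\<in>topspace X. f x / k x)"
      have nz: "g x \<noteq> 0" if "x \<in> topspace X" "x \<notin> Z" for x
        using g(2) that by (force simp: mc_ball_def u_def)
      have "k \<in> carrier (Cc X)"
        unfolding k_def using g sub by (intro Cc_clopen_cases Z const_in_Cc) auto
      moreover have "k x \<noteq> 0" if "x \<in> topspace X" for x
        using nz that by (simp add: k_def)
      ultimately have "h \<in> carrier (Cc X)"
        unfolding h_def using f by (intro Cc_divide) auto
      then have "g \<otimes>\<^bsub>Cc X\<^esub> h \<in> I"
        using I g by (simp add: ideal.I_r_closed)
      moreover have "g \<otimes>\<^bsub>Cc X\<^esub> h = f"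
      proof
        fix x show "(g \<otimes>\<^bsub>Cc X\<^esub> h) x = f x"
        proof (cases "x \<in> topspace X")
          case True
          then show ?thesis
            using nz by (cases "x \<in> Z") (auto simp: Cc_simps h_def k_def Z_def)
        next
          case False
          then show ?thesis
            using f by (simp add: Cc_simps extensional_def)
        qed
      qed
      ultimately show "f \<in> I"
        by simp
    qed
    then have "mc_ball X f u \<subseteq> carrier (Cc X) - I"
      using f by (auto simp: mc_ball_def)
    moreover have "f \<in> mc_ball X f u"
      using f u by (auto simp: mc_ball_def positive_unit_def)
    ultimately show ?thesis
      using openin_mc_ball[of f X u] f u by auto
  qed
  then have "openin (mc_topology X) (carrier (Cc X) - I)"
    by (subst openin_subopen) blast
  then show ?thesis
    using sub by (simp add: closedin_def topspace_mc_topology)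
qed

section \<open>The ideal of functions vanishing near a point\<close>

text \<open>The counterpart in \<open>Cc X\<close> of the ideal usually written O_x in rings of
  continuous functions: the elements whose germ at \<open>x\<close> is zero.\<close>

definition germ_ideal :: "'a topology \<Rightarrow> 'a \<Rightarrow> ('a \<Rightarrow> real) set" where
  "germ_ideal X x =
     {f \<in> carrier (Cc X). \<exists>U. openin X U \<and> x \<in> U \<and> (\<forall>y\<in>U. f y = 0)}"

lemma ideal_germ_ideal:
  assumes x: "x \<in> topspace X"
  shows "ideal (germ_ideal X x) (Cc X)"
proof -
  interpret R: cring "Cc X"
    by (rule cring_Cc)
  have mult: "f \<otimes>\<^bsub>Cc X\<^esub> g \<in> germ_ideal X x"
    if f: "f \<in> germ_ideal X x" and g: "g \<in> carrier (Cc X)" for f g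
  proof -
    from f obtain U where "openin X U" "x \<in> U" "\<forall>y\<in>U. f y = 0" "f \<in> carrier (Cc X)"
      by (auto simp: germ_ideal_def)
    moreover from this have "\<forall>y\<in>U. (f \<otimes>\<^bsub>Cc X\<^esub> g) y = 0"
      using openin_subset[of X U] by (auto simp: Cc_simps(2))
    ultimately show ?thesis
      using g unfolding germ_ideal_def by blast
  qed
  show ?thesis
  proof (rule idealI)
    show "subgroup (germ_ideal X x) (add_monoid (Cc X))"
    proof (rule group.subgroupI)
      show "group (add_monoid (Cc X))"
        by (rule R.add.is_group)
      show "germ_ideal X x \<subseteq> carrier (add_monoid (Cc X))"
        by (auto simp: germ_ideal_def)
      have "\<zero>\<^bsub>Cc X\<^esub> \<in> germ_ideal X x"
        using x openin_subset[of X] R.zero_closed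
        by (auto simp: germ_ideal_def Cc_simps(5) intro!: exI[of _ "topspace X"])
      then show "germ_ideal X x \<noteq> {}"
        by blast
      fix f assume f: "f \<in> germ_ideal X x"
      then have fC: "f \<in> carrier (Cc X)"
        by (simp add: germ_ideal_def)
      \<comment> \<open>The negative of \<open>f\<close> is \<open>f\<close> times -1, so closure
        under inverses follows from absorption.\<close>
      have "f \<otimes>\<^bsub>Cc X\<^esub> (\<ominus>\<^bsub>Cc X\<^esub> \<one>\<^bsub>Cc X\<^esub>) \<in> germ_ideal X x"
        using f by (intro mult R.a_inv_closed R.one_closed)
      then have "\<ominus>\<^bsub>Cc X\<^esub> f \<in> germ_ideal X x"
        using fC by (simp add: R.r_minus)
      then show "inv\<^bsub>add_monoid (Cc X)\<^esub> f \<in> germ_ideal X x"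
        by (simp add: a_inv_def)
      fix g assume g: "g \<in> germ_ideal X x"
      then have gC: "g \<in> carrier (Cc X)"
        by (simp add: germ_ideal_def)
      from f g obtain U V where UV: "openin X U" "x \<in> U" "\<forall>y\<in>U. f y = 0"
          "openin X V" "x \<in> V" "\<forall>y\<in>V. g y = 0"
        by (auto simp: germ_ideal_def)
      have "openin X (U \<inter> V) \<and> x \<in> U \<inter> V \<and> (\<forall>y\<in>U \<inter> V. (f \<oplus>\<^bsub>Cc X\<^esub> g) y = 0)"
        using UV openin_subset[of X U] by (auto simp: Cc_simps(3))
      then have "f \<oplus>\<^bsub>Cc X\<^esub> g \<in> germ_ideal X x"
        using R.a_closed[OF fC gC] unfolding germ_ideal_def by blast
      then show "f \<otimes>\<^bsub>add_monoid (Cc X)\<^esub> g \<in> germ_ideal X x"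
        by simp
    qed
    fix f g assume fg: "f \<in> germ_ideal X x" "g \<in> carrier (Cc X)"
    then show "f \<otimes>\<^bsub>Cc X\<^esub> g \<in> germ_ideal X x"
      by (rule mult)
    then show "g \<otimes>\<^bsub>Cc X\<^esub> f \<in> germ_ideal X x"
      using fg by (simp add: R.m_comm germ_ideal_def)
  qed (rule R.ring_axioms)
qed

lemma germ_ideal_proper:
  assumes "x \<in> topspace X"
  shows "germ_ideal X x \<noteq> carrier (Cc X)"
proof
  assume "germ_ideal X x = carrier (Cc X)"
  then have "(\<lambda>x\<in>topspace X. 1) \<in> germ_ideal X x"
    using const_in_Cc by blast
  with assms show False
    by (auto simp: germ_ideal_def)
qed

text \<open>Near \<open>x\<close> the values of \<open>f\<close> are small, so resetting
  \<open>f\<close> to 0 on a small clopen set around \<open>x\<close> stays within any prescribed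
  neighbourhood of \<open>f\<close> and lands in the ideal.\<close>

lemma closed_germ_ideal_contains:
  assumes zd: "zero_dimensional_space X" and x: "x \<in> topspace X"
    and closed: "closedin (mc_topology X) (germ_ideal X x)"
    and f: "f \<in> carrier (Cc X)" "f x = 0"
  shows "f \<in> germ_ideal X x"
proof (rule ccontr)
  assume "f \<notin> germ_ideal X x"
  moreover have "openin (mc_topology X) (carrier (Cc X) - germ_ideal X x)"
    using closed by (simp add: closedin_def topspace_mc_topology)
  ultimately obtain g u where g: "g \<in> carrier (Cc X)" and u: "positive_unit X u"
    and fb: "f \<in> mc_ball X g u" and disj: "mc_ball X g u \<subseteq> carrier (Cc X) - germ_ideal X x"
    using f(1) openin_mc_topology_mc_ball[of X _ f] by (metis DiffI)
  \<comment> \<open>The ball need not be centred at \<open>f\<close>; \<open>u - |f - g|\<close> is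
    the room left around \<open>f\<close> in it. Where \<open>|f|\<close> is below this room,
    \<open>|0 - g| \<le> |f| + |f - g| < u\<close>, so the value 0 is admissible. At
    \<open>x\<close> the room is positive and \<open>f x = 0\<close>.\<close>
  have "continuous_map X euclideanreal (\<lambda>y. u y - \<bar>f y - g y\<bar>)"
    using f g u by (intro continuous_intros) (auto simp: Cc_simps positive_unit_iff)
  then have "openin X {y \<in> topspace X. \<bar>f y\<bar> < u y - \<bar>f y - g y\<bar>}"
    using f by (intro openin_abs_less) (auto simp: Cc_simps)
  moreover have "x \<in> {y \<in> topspace X. \<bar>f y\<bar> < u y - \<bar>f y - g y\<bar>}"
    using x f fb by (auto simp: mc_ball_def)
  ultimately obtain C where C: "openin X C" "closedin X C" "x \<in> C"
    and small: "C \<subseteq> {y \<in> topspace X. \<bar>f y\<bar> < u y - \<bar>f y - g y\<bar>}"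
    by (rule zero_dimensional_space_clopen_base[OF zd])
  define h where "h = (\<lambda>y\<in>topspace X. if y \<in> C then (\<lambda>x\<in>topspace X. 0) y else f y)"
  have h: "h \<in> carrier (Cc X)"
    unfolding h_def using C f by (intro Cc_clopen_cases const_in_Cc)
  have "\<bar>h y - g y\<bar> < u y" if "y \<in> topspace X" for y
  proof (cases "y \<in> C")
    case True
    then have "\<bar>f y\<bar> < u y - \<bar>f y - g y\<bar>"
      using small by auto
    with True that show ?thesis
      by (simp add: h_def)
  next
    case False
    with that fb show ?thesis
      by (auto simp: h_def mc_ball_def)
  qed
  then have "h \<in> mc_ball X g u"
    using h by (simp add: mc_ball_def)
  moreover have "\<forall>y\<in>C. h y = 0"
    using C openin_subset[of X C] by (auto simp: h_def)
  then have "h \<in> germ_ideal X x"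
    using h C by (auto simp: germ_ideal_def)
  ultimately show False
    using disj by blast
qed

section \<open>Zero sets inside G-delta sets\<close>

text \<open>Clopen sets \<open>C n\<close> around \<open>x\<close> are chosen inside the open sets
  defining \<open>S\<close>. The function records when a point first leaves them, so its zeros in
  the space are the points lying in every \<open>C n\<close>.\<close>

lemma zero_set_between_point_and_gdelta:
  assumes zd: "zero_dimensional_space X" and S: "gdelta_in X S" and x: "x \<in> S"
  obtains f where "f \<in> carrier (Cc X)" "f x = 0" "\<And>y. y \<in> topspace X \<Longrightarrow> f y = 0 \<Longrightarrow> y \<in> S"
proof -
  obtain U :: "nat \<Rightarrow> 'a set" where U: "\<And>n. openin X (U n)" and SU: "\<Inter> (range U) = S"
    using S unfolding gdelta_in_descending by (elim exE conjE) blast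
  have "\<exists>C. openin X C \<and> closedin X C \<and> x \<in> C \<and> C \<subseteq> U n" for n
    proof -
    have "x \<in> U n"
      using x SU by auto
    then show ?thesis
      using zero_dimensional_space_clopen_base[OF zd U] by metis
  qed
  then obtain C where C: "\<And>n. openin X (C n)" "\<And>n. closedin X (C n)"
      "\<And>n. x \<in> C n" "\<And>n. C n \<subseteq> U n"
    by metis
  \<comment> \<open>The usual sum of \<open>2\<^sup>-\<^sup>n\<close> times the indicator of the complement of \<open>C n\<close> may have uncountable
    range, so only the first \<open>C n\<close> that misses the point is recorded.\<close>
  define f where "f = (\<lambda>y. if \<exists>n. y \<notin> C n then inverse (real (Suc (LEAST n. y \<notin> C n))) else 0)"
  have cont: "continuous_map X Met_TC.mtopology f"
    unfolding Met_TC.continuous_map_to_metric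
  proof (intro ballI allI impI)
    fix y and e :: real assume y: "y \<in> topspace X" and e: "0 < e"
    \<comment> \<open>For \<open>N = 0\<close> the inner intersection is \<open>UNIV\<close>; the
      factor \<open>topspace X\<close> keeps the set open.\<close>
    have D: "openin X (topspace X \<inter> (\<Inter>k\<in>{..<N}. C k))" for N
      using C(1) by (cases "N = 0") (auto intro!: openin_Int openin_INT2)
    show "\<exists>V. openin X V \<and> y \<in> V \<and> (\<forall>z\<in>V. f z \<in> Met_TC.mball (f y) e)"
    proof (cases "\<exists>n. y \<notin> C n")
      case True
      define N where "N = (LEAST n. y \<notin> C n)"
      \<comment> \<open>The \<open>C k\<close> need not be nested, so all earlier ones are imposed.
        Every point of \<open>?V\<close> first exits at \<open>N\<close>, hence \<open>f\<close> is
        constant there; removing \<open>C N\<close> keeps the set open because \<open>C N\<close> is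
        closed.\<close>
      let ?V = "(topspace X \<inter> (\<Inter>k\<in>{..<N}. C k)) - C N"
      have N: "y \<notin> C N"
        unfolding N_def using True by (rule LeastI_ex)
      have N_min: "y \<in> C k" if "k < N" for k
        using not_less_Least[of k "\<lambda>n. y \<notin> C n"] that by (simp add: N_def)
      have "(LEAST n. z \<notin> C n) = N" if "z \<in> ?V" for z
      proof (rule Least_equality)
        show "z \<notin> C N"
          using that by simp
        show "N \<le> k" if "z \<notin> C k" for k
          using that \<open>z \<in> ?V\<close> by (meson DiffD1 INT_D Int_iff lessThan_iff not_less)
      qed
      then have fV: "f z = inverse (real (Suc N))" if "z \<in> ?V" for z
        using that unfolding f_def by (metis DiffD2)
      moreover have "openin X ?V"
        using D C(2) by (rule openin_diff)
      moreover have yV: "y \<in> ?V"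
        using N N_min y by simp
      ultimately show ?thesis
        using e fV[OF yV] by (intro exI[of _ ?V]) simp
    next
      case False
      obtain N where N: "inverse (real (Suc N)) < e"
        using reals_Archimedean[OF e] by auto
      \<comment> \<open>Here \<open>f y = 0\<close>. A point of \<open>?V\<close> exits at index
        \<open>N\<close> or later, or never, so its value is at most
        \<open>inverse (real (Suc N))\<close>, which is below \<open>e\<close>.\<close>
      let ?V = "topspace X \<inter> (\<Inter>k\<in>{..<N}. C k)"
      have "\<bar>f z\<bar> < e" if z: "z \<in> ?V" for z
      proof (cases "\<exists>n. z \<notin> C n")
        case True
        then have "z \<notin> C (LEAST n. z \<notin> C n)"
          by (rule LeastI_ex)
        then have "N \<le> (LEAST n. z \<notin> C n)"
          using z by (meson INT_D Int_iff lessThan_iff not_less)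
        then have "inverse (real (Suc (LEAST n. z \<notin> C n))) \<le> inverse (real (Suc N))"
          by (intro le_imp_inverse_le) auto
        then have "inverse (real (Suc (LEAST n. z \<notin> C n))) < e"
          using N by (rule le_less_trans)
        with True show ?thesis
          by (simp add: f_def)
      qed (use e in \<open>simp add: f_def\<close>)
      moreover have "f y = 0"
        using False by (simp add: f_def)
      ultimately show ?thesis
        using D[of N] y False by (intro exI[of _ ?V]) simp
    qed
  qed
  have "f ` topspace X \<subseteq> insert 0 (range (\<lambda>n. inverse (real (Suc n))))"
    by (auto simp: f_def)
  then have "countable (f ` topspace X)"
    by (rule countable_subset) auto
  then have "restrict f (topspace X) \<in> carrier (Cc X)"
    using cont by (intro restrict_in_Cc) auto
  moreover have "restrict f (topspace X) x = 0"
    using C(3) x gdelta_in_subset[OF S] by (auto simp: f_def)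
  moreover have "y \<in> S" if "y \<in> topspace X" "restrict f (topspace X) y = 0" for y
  proof -
    have "y \<in> C n" for n
    proof (rule ccontr)
      assume "y \<notin> C n"
      then have "f y = inverse (real (Suc (LEAST n. y \<notin> C n)))"
        unfolding f_def by (metis (no_types))
      with that show False
        by simp
    qed
    then show ?thesis
      using C(4) SU by blast
  qed
  ultimately show thesis
    by (rule that)
qed

theorem theorem3p10:
  fixes X :: "'a topology"
  assumes "zero_dimensional_space X" and "Hausdorff_space X"
  shows "P_space X \<longleftrightarrow>
    (\<forall>I. ideal I (Cc X) \<and> I \<noteq> carrier (Cc X) \<longrightarrow> closedin (mc_topology X) I)"
proof
  assume "P_space X"
  then show "\<forall>I. ideal I (Cc X) \<and> I \<noteq> carrier (Cc X) \<longrightarrow> closedin (mc_topology X) I"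
    using P_space_imp_closedin_ideal by blast
next
  assume closed: "\<forall>I. ideal I (Cc X) \<and> I \<noteq> carrier (Cc X) \<longrightarrow> closedin (mc_topology X) I"
  have "openin X S" if S: "gdelta_in X S" for S
  proof (subst openin_subopen, rule ballI)
    fix x assume x: "x \<in> S"
    then have xX: "x \<in> topspace X"
      using gdelta_in_subset[OF S] by blast
    obtain f where f: "f \<in> carrier (Cc X)" "f x = 0"
      and zeros: "\<And>y. y \<in> topspace X \<Longrightarrow> f y = 0 \<Longrightarrow> y \<in> S"
      using zero_set_between_point_and_gdelta[OF assms(1) S x] by metis
    \<comment> \<open>Each point of \<open>S\<close> calls for its own ideal. Its closedness turns
      vanishing of \<open>f\<close> at \<open>x\<close> into vanishing on a neighbourhood, which
      then lies inside \<open>S\<close>.\<close>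
    have "closedin (mc_topology X) (germ_ideal X x)"
      using closed ideal_germ_ideal[OF xX] germ_ideal_proper[OF xX] by blast
    then have "f \<in> germ_ideal X x"
      using closed_germ_ideal_contains[OF assms(1) xX] f by blast
    then obtain U where U: "openin X U" "x \<in> U" "\<forall>y\<in>U. f y = 0"
      by (auto simp: germ_ideal_def)
    have "U \<subseteq> S"
      using U zeros openin_subset[OF U(1)] by auto
    with U show "\<exists>T. openin X T \<and> x \<in> T \<and> T \<subseteq> S"
      by auto
  qed
  then show "P_space X"
    using assms zero_dimensional_imp_completely_regular_space
    by (auto simp: P_space_def Tychonoff_space_def)
qed

end
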